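(* Let $0<q<1$ and let $1\le\underline{k}\le\overline{k}$ be integers. Put $x_1=qx$ and $x_0=(1-q)x$. As formal power series in $x$ with coefficients in $\mathbb{R}[y]$, $$\sum_{n,m}\lambda_{\underline{k}\le\overline{k}}(n,m)x^ny^m=\frac{2-x_1-x_0+(y-1)\Big(\big(x_1^{\underline{k}}-x_1^{\overline{k}+1}\big)(1-x_0)+\big(x_0^{\underline{k}}-x_0^{\overline{k}+1}\big)(1-x_1)\Big)}{(1-x_1)(1-x_0)-\Big((y-1)\big(x_1^{\underline{k}}-x_1^{\overline{k}+1}\big)+x_1\Big)\Big((y-1)\big(x_0^{\underline{k}}-x_0^{\overline{k}+1}\big)+x_0\Big)}.$$
   Context: A random $n$-string is a binary string of length $n$ whose bits are independent, each equal to $1$ with probability $q$. A (nonnull) run is a maximal block, of length at least $1$, of consecutive equal bits. For $n\ge 1$, $\lambda_{\underline{k}\le\overline{k}}(n,m)$ is the probability that in a random $n$-string the total number of runs of ones and runs of zeros whose length lies in $[\underline{k},\overline{k}]$ is exactly $m$. By convention $\lambda_{\underline{k}\le\overline{k}}(0,m)=2$ if $m=0$ and $0$ otherwise (it is the sum of two terms $\lambda^0+\lambda^1$, for strings starting with $0$ and with $1$, each initialised as $1$ at $n=m=0$), and the quantity is $0$ for $n<0$ or $m<0$. The sum is over all integers $n,m$. *)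

theory Defs
  imports "HOL-Probability.Probability" "HOL-Computational_Algebra.Formal_Power_Series"
begin

text \<open>Binary strings are lists of type \<^typ>\<open>bool list\<close>, with \<^term>\<open>True\<close> for the bit 1 and
  \<^term>\<open>False\<close> for the bit 0. The pair \<open>(a, b)\<close> stands for the positions \<open>a, \<dots>, b - 1\<close>.\<close>

definition const_block :: "bool \<Rightarrow> bool list \<Rightarrow> nat \<Rightarrow> nat \<Rightarrow> bool" where
  "const_block c w a b \<longleftrightarrow> a < b \<and> b \<le> length w \<and> (\<forall>i\<in>{a..<b}. w ! i = c)"

definition is_run :: "bool \<Rightarrow> bool list \<Rightarrow> nat \<Rightarrow> nat \<Rightarrow> bool" where
  "is_run c w a b \<longleftrightarrow> const_block c w a b \<and>
     (\<forall>a' b'. a' \<le> a \<and> b \<le> b' \<and> const_block c w a' b' \<longrightarrow> a' = a \<and> b' = b)"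

definition num_runs :: "bool \<Rightarrow> nat \<Rightarrow> nat \<Rightarrow> bool list \<Rightarrow> nat" where
  "num_runs c k K w = card {(a, b). is_run c w a b \<and> b - a \<in> {k..K}}"

definition random_string :: "real \<Rightarrow> nat \<Rightarrow> bool list pmf" where
  "random_string q n = replicate_pmf n (bernoulli_pmf q)"

text \<open>The value at \<open>n = 0\<close> is a convention and not a probability.\<close>

definition run_prob :: "real \<Rightarrow> nat \<Rightarrow> nat \<Rightarrow> nat \<Rightarrow> nat \<Rightarrow> real" where
  "run_prob q k K n m =
     (if n = 0 then (if m = 0 then 2 else 0)
      else measure_pmf.prob (random_string q n)
             {w. num_runs True k K w + num_runs False k K w = m})"

text \<open>The inner sum has finite support by \<open>finite_run_prob_support\<close>, so it is a genuine
  polynomial in the variable y; see \<open>coeff_run_gf\<close>.\<close>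

definition run_gf :: "real \<Rightarrow> nat \<Rightarrow> nat \<Rightarrow> real poly fps" where
  "run_gf q k K =
     Abs_fps (\<lambda>n. \<Sum>m | run_prob q k K n m \<noteq> 0. monom (run_prob q k K n m) m)"

lemma finite_run_prob_support: "finite {m. run_prob q k K n m \<noteq> 0}"
proof (cases "n = 0")
  case True
  have "{m. run_prob q k K n m \<noteq> 0} \<subseteq> {0}"
    using True by (auto simp: run_prob_def split: if_splits)
  then show ?thesis using finite_subset by blast
next
  case False
  let ?f = "\<lambda>w. num_runs True k K w + num_runs False k K w"
  let ?S = "set_pmf (random_string q n)"
  have "?S \<subseteq> {w. set w \<subseteq> UNIV \<and> length w = n}"
    by (auto simp: random_string_def set_replicate_pmf)
  then have fin: "finite ?S"
    using finite_lists_length_eq[of "UNIV :: bool set" n] finite_subset by auto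
  have "m \<in> ?f ` ?S" if "run_prob q k K n m \<noteq> 0" for m
  proof (rule ccontr)
    assume "m \<notin> ?f ` ?S"
    then have "?S \<inter> {w. ?f w = m} = {}" by auto
    then have "measure_pmf.prob (random_string q n) {w. ?f w = m} = 0"
      by (simp add: measure_pmf_zero_iff)
    with that False show False by (simp add: run_prob_def)
  qed
  then have "{m. run_prob q k K n m \<noteq> 0} \<subseteq> ?f ` ?S" by blast
  then show ?thesis using fin finite_subset by blast
qed

lemma coeff_run_gf: "coeff (fps_nth (run_gf q k K) n) m = run_prob q k K n m"
  using finite_run_prob_support[of q k K n]
  by (simp add: run_gf_def coeff_sum)

end

theory Submission
  imports Defs
begin

text \<open>
  The formula comes from splitting off the first run of a string. Let \<open>A\<^sub>c\<close> be the generating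
  function of the strings whose first bit is \<open>c\<close>, in which a string contributes its probability,
  \<open>x\<close> to its length and \<open>y\<close> to the number of its runs with length in \<open>[k, K]\<close>; the empty string
  is counted in both \<open>A\<^sub>0\<close> and \<open>A\<^sub>1\<close>, which is exactly the convention that gives the value 2 at
  \<open>n = 0\<close>. A nonempty string starting with \<open>c\<close> is, in a unique way, a block of \<open>j \<ge> 1\<close> copies of
  \<open>c\<close> followed by a string that is empty or starts with the other bit, and its runs are this block
  together with the runs of the rest. Probabilities multiply along this splitting, so with
  \<open>R\<^sub>c\<close> the sum of \<open>x\<^sub>c ^ j\<close> over \<open>j \<ge> 1\<close>, where the terms with \<open>k \<le> j \<le> K\<close> carry an
  extra factor \<open>y\<close>, one gets (lemma \<open>string_gf_rec\<close>)
  \<open>A\<^sub>1 = 1 + R\<^sub>1 A\<^sub>0\<close> and \<open>A\<^sub>0 = 1 + R\<^sub>0 A\<^sub>1\<close>.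

  The series \<open>R\<^sub>c\<close> is a geometric series with a window of coefficients multiplied by \<open>y\<close>, so
  \<open>(1 - x\<^sub>c) R\<^sub>c\<close> is the polynomial \<open>P\<^sub>c = x\<^sub>c + (y - 1) (x\<^sub>c ^ k - x\<^sub>c ^ (K + 1))\<close>
  (lemma \<open>first_run_gf_mult\<close>). Solving the linear system gives
  \<open>A\<^sub>1 ((1 - x\<^sub>1) (1 - x\<^sub>0) - P\<^sub>1 P\<^sub>0) = (1 - x\<^sub>0) (1 - x\<^sub>1 + P\<^sub>1)\<close> and its mirror image, and
  adding the two yields the claim. The denominator is a unit because its constant coefficient
  is 1.
\<close>

section \<open>Runs and the removal of the first run\<close>

text \<open>Maximality among all enclosing blocks is a condition on the two adjacent bits only: any
  strictly larger constant block would contain one of them.\<close>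

lemma is_run_iff:
  "is_run c w a b \<longleftrightarrow>
     const_block c w a b \<and> (0 < a \<longrightarrow> w ! (a - 1) \<noteq> c) \<and> (b < length w \<longrightarrow> w ! b \<noteq> c)"
    (is "?L \<longleftrightarrow> ?R")
proof
  assume L: ?L
  then have blk: "const_block c w a b" and
    mx: "\<And>a' b'. a' \<le> a \<Longrightarrow> b \<le> b' \<Longrightarrow> const_block c w a' b' \<Longrightarrow> a' = a \<and> b' = b"
    unfolding is_run_def by auto
  have "w ! (a - 1) \<noteq> c" if "0 < a"
  proof
    assume eq: "w ! (a - 1) = c"
    have "w ! i = c" if "i \<in> {a - 1..<b}" for i
    proof (cases "i = a - 1")
      case False
      with that have "i \<in> {a..<b}" by auto
      with blk show ?thesis by (auto simp: const_block_def)
    qed (use eq in simp)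
    with blk have "const_block c w (a - 1) b"
      by (auto simp: const_block_def)
    with mx[of "a - 1" b] \<open>0 < a\<close> show False by simp
  qed
  moreover have "w ! b \<noteq> c" if "b < length w"
  proof
    assume "w ! b = c"
    with blk that have "const_block c w a (Suc b)"
      by (auto simp: const_block_def less_Suc_eq)
    with mx[of a "Suc b"] show False by simp
  qed
  ultimately show ?R using blk by simp
next
  assume R: ?R
  have "a' = a \<and> b' = b" if le: "a' \<le> a" "b \<le> b'" and blk': "const_block c w a' b'" for a' b'
  proof -
    have ab: "a < b" using R by (simp add: const_block_def)
    have "\<not> a' < a"
    proof
      assume "a' < a"
      then have "a - 1 \<in> {a'..<b'}" "0 < a" using le ab by auto
      with blk' R show False by (auto simp: const_block_def)
    qed
    moreover have "\<not> b < b'"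
    proof
      assume "b < b'"
      then have "b \<in> {a'..<b'}" "b < length w" using le ab blk' by (auto simp: const_block_def)
      with blk' R show False by (auto simp: const_block_def)
    qed
    ultimately show ?thesis using le by simp
  qed
  with R show ?L unfolding is_run_def by blast
qed

lemma const_block_append_shift:
  assumes "length u \<le> a"
  shows "const_block d (u @ v) a b \<longleftrightarrow> const_block d v (a - length u) (b - length u)"
proof -
  let ?j = "length u"
  have "(\<forall>i\<in>{a..<b}. (u @ v) ! i = d) \<longleftrightarrow> (\<forall>i\<in>{a - ?j..<b - ?j}. v ! i = d)"
  proof (rule iffI; rule ballI)
    fix i assume *: "\<forall>i\<in>{a..<b}. (u @ v) ! i = d" and i: "i \<in> {a - ?j..<b - ?j}"
    then have "i + ?j \<in> {a..<b}" using assms by auto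
    with * have "(u @ v) ! (i + ?j) = d" by blast
    then show "v ! i = d" by (simp add: nth_append)
  next
    fix i assume *: "\<forall>i\<in>{a - ?j..<b - ?j}. v ! i = d" and i: "i \<in> {a..<b}"
    then have "i - ?j \<in> {a - ?j..<b - ?j}" "\<not> i < ?j" using assms by auto
    with * show "(u @ v) ! i = d" by (simp add: nth_append)
  qed
  then show ?thesis using assms by (auto simp: const_block_def)
qed

text \<open>The block in front is itself a run, since it ends where the bit changes. For the same
  reason no run of the rest extends to the left into the block, so those runs are just shifted.\<close>

lemma is_run_replicate_append:
  assumes j: "0 < j" and v: "v = [] \<or> hd v = (\<not> c)"
  shows "is_run d (replicate j c @ v) a b \<longleftrightarrow>
           d = c \<and> a = 0 \<and> b = j \<or> j \<le> a \<and> is_run d v (a - j) (b - j)"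
proof -
  let ?w = "replicate j c @ v"
  have lo: "?w ! i = c" if "i < j" for i using that by (simp add: nth_append)
  have hi: "?w ! i = v ! (i - j)" if "j \<le> i" for i using that by (simp add: nth_append)
  have v0: "v ! 0 = (\<not> c)" if "0 < length v" using v that by (auto simp: hd_conv_nth)
  show ?thesis
  proof (cases "a < j")
    case True
    have "d = c \<and> a = 0 \<and> b = j" if run: "is_run d ?w a b"
    proof -
      have blk: "const_block d ?w a b" and l: "0 < a \<Longrightarrow> ?w ! (a - 1) \<noteq> d"
        and r: "b < length ?w \<Longrightarrow> ?w ! b \<noteq> d"
        using run by (auto simp only: is_run_iff)
      have "?w ! a = d" using blk by (simp add: const_block_def)
      then have d: "d = c" using lo[OF True] by simp
      have a: "a = 0" using l lo[of "a - 1"] d True by auto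
      have "\<not> b < j" using r lo[of b] d by auto
      moreover have "\<not> j < b"
      proof
        assume jb: "j < b"
        have "j \<in> {a..<b}" using jb True by simp
        with blk have "?w ! j = d" unfolding const_block_def by blast
        moreover have "0 < length v"
          using blk jb unfolding const_block_def length_append length_replicate by linarith
        ultimately show False using hi[of j] v0 d by simp
      qed
      ultimately show ?thesis using d a by simp
    qed
    moreover have "is_run c ?w 0 j"
      using j lo hi[of j] v0 by (auto simp: is_run_iff const_block_def)
    ultimately show ?thesis using True by auto
  next
    case False
    have shift: "const_block d ?w a b \<longleftrightarrow> const_block d v (a - j) (b - j)"
      using const_block_append_shift[of "replicate j c" a d v b] False by simp
    have "(0 < a \<longrightarrow> ?w ! (a - 1) \<noteq> d) \<longleftrightarrow> (0 < a - j \<longrightarrow> v ! (a - j - 1) \<noteq> d)"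
      if blk: "const_block d v (a - j) (b - j)"
    proof (cases "a = j")
      case True
      have "v ! 0 = d" "0 < length v" using blk True by (auto simp: const_block_def)
      with v0 lo[of "a - 1"] True j show ?thesis by auto
    next
      case aj: False
      then show ?thesis using False hi[of "a - 1"] by (simp add: diff_right_commute)
    qed
    moreover have "(b < length ?w \<longrightarrow> ?w ! b \<noteq> d) \<longleftrightarrow> (b - j < length v \<longrightarrow> v ! (b - j) \<noteq> d)"
      if "const_block d v (a - j) (b - j)"
    proof -
      have "j \<le> b" using that unfolding const_block_def by linarith
      then show ?thesis using hi[of b] by auto
    qed
    ultimately show ?thesis using False j shift unfolding is_run_iff by auto
  qed
qed

lemma finite_runs: "finite {(a, b). is_run d v a b \<and> b - a \<in> {k..K}}"
  by (rule finite_subset[of _ "{..length v} \<times> {..length v}"])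
     (auto simp: is_run_def const_block_def)

lemma num_runs_replicate_append:
  assumes j: "0 < j" and v: "v = [] \<or> hd v = (\<not> c)"
  shows "num_runs d k K (replicate j c @ v) = of_bool (d = c \<and> j \<in> {k..K}) + num_runs d k K v"
proof -
  let ?S = "{(a, b). is_run d v a b \<and> b - a \<in> {k..K}}"
  let ?F = "if d = c \<and> j \<in> {k..K} then {(0, j)} else {}"
  let ?sh = "\<lambda>(a, b). (a + j, b + j)"
  have "{(a, b). is_run d (replicate j c @ v) a b \<and> b - a \<in> {k..K}} = ?F \<union> ?sh ` ?S"
    (is "?L = ?R")
  proof (intro subset_antisym subrelI)
    fix a b assume "(a, b) \<in> ?L"
    then have run: "is_run d (replicate j c @ v) a b" and len: "b - a \<in> {k..K}" by simp_all
    show "(a, b) \<in> ?R"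
    proof (cases "d = c \<and> a = 0 \<and> b = j")
      case True
      then show ?thesis using len by simp
    next
      case False
      then have *: "j \<le> a" "is_run d v (a - j) (b - j)"
        using run is_run_replicate_append[OF assms] by auto
      then have "j \<le> b" unfolding is_run_def const_block_def by linarith
      with * len have "(a, b) = ?sh (a - j, b - j)" "(a - j, b - j) \<in> ?S" by auto
      then show ?thesis by blast
    qed
  next
    fix a b assume "(a, b) \<in> ?R"
    then show "(a, b) \<in> ?L"
      unfolding is_run_replicate_append[OF assms] by (auto split: if_splits)
  qed
  moreover have "?F \<inter> ?sh ` ?S = {}" using j by auto
  moreover have "card (?sh ` ?S) = card ?S" by (rule card_image) (auto simp: inj_on_def)
  ultimately show ?thesis
    unfolding num_runs_def using finite_runs[of d v k K] by (simp add: card_Un_disjoint)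
qed

definition total_runs :: "nat \<Rightarrow> nat \<Rightarrow> bool list \<Rightarrow> nat" where
  "total_runs k K w = num_runs True k K w + num_runs False k K w"

lemma total_runs_Nil: "total_runs k K [] = 0"
proof -
  have "\<not> is_run c [] a b" for c a b by (simp add: is_run_def const_block_def)
  then show ?thesis by (simp add: total_runs_def num_runs_def)
qed

lemma total_runs_replicate_append:
  assumes "0 < j" and "v = [] \<or> hd v = (\<not> c)"
  shows "total_runs k K (replicate j c @ v) = of_bool (j \<in> {k..K}) + total_runs k K v"
  unfolding total_runs_def num_runs_replicate_append[OF assms] by (cases c) auto


section \<open>Strings with a prescribed first bit\<close>

text \<open>The empty string belongs to both families. It is what remains when a string consists of a
  single run, and counting it twice matches the value 2 of \<^const>\<open>run_prob\<close> at length 0.\<close>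

definition strings_from :: "bool \<Rightarrow> nat \<Rightarrow> bool list set" where
  "strings_from c n = {w. length w = n \<and> (w = [] \<or> hd w = c)}"

lemma finite_strings_from: "finite (strings_from c n)"
  by (rule finite_subset[OF _ finite_lists_length_eq[of "UNIV :: bool set" n]])
     (auto simp: strings_from_def)

lemma strings_from_0: "strings_from c 0 = {[]}"
  by (auto simp: strings_from_def)

text \<open>The bijection behind the recursion: a string is determined by the length \<open>j\<close> of its first
  run and by what follows it. The case \<open>n = 0\<close> is excluded because the empty string has no first
  run.\<close>

lemma sum_strings_first_run:
  fixes f :: "bool list \<Rightarrow> 'a :: comm_monoid_add"
  assumes "0 < n"
  shows "(\<Sum>w\<in>strings_from c n. f w) =
           (\<Sum>j=1..n. \<Sum>v\<in>strings_from (\<not> c) (n - j). f (replicate j c @ v))"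
proof -
  have "(\<Sum>w\<in>strings_from c n. f w) =
          (\<Sum>(j, v)\<in>(SIGMA j:{1..n}. strings_from (\<not> c) (n - j)). f (replicate j c @ v))"
  proof (rule sum.reindex_bij_witness[where
      i = "\<lambda>(j, v). replicate j c @ v" and
      j = "\<lambda>w. (length (takeWhile ((=) c) w), dropWhile ((=) c) w)"])
    fix w assume w: "w \<in> strings_from c n"
    let ?t = "takeWhile ((=) c) w" and ?d = "dropWhile ((=) c) w"
    have rep: "replicate (length ?t) c = ?t"
      by (metis (full_types) replicate_length_same set_takeWhileD)
    then show split: "(case (length ?t, ?d) of (j, v) \<Rightarrow> replicate j c @ v) = w" by simp
    then show "(case (length ?t, ?d) of (j, v) \<Rightarrow> f (replicate j c @ v)) = f w" by simp
    have "length ?t + length ?d = n"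
      using w by (simp add: strings_from_def flip: length_append)
    moreover have "?t \<noteq> []" using w assms by (cases w) (auto simp: strings_from_def)
    moreover have "?d = [] \<or> hd ?d = (\<not> c)" using hd_dropWhile[of "(=) c" w] by auto
    ultimately show "(length ?t, ?d) \<in> (SIGMA j:{1..n}. strings_from (\<not> c) (n - j))"
      by (auto simp: strings_from_def Suc_le_eq)
  next
    fix p assume "p \<in> (SIGMA j:{1..n}. strings_from (\<not> c) (n - j))"
    then obtain j v where p: "p = (j, v)" and j: "1 \<le> j" "j \<le> n" and v: "v \<in> strings_from (\<not> c) (n - j)"
      by auto
    have "takeWhile ((=) c) v = []" "dropWhile ((=) c) v = v"
      using v by (cases v; auto simp: strings_from_def)+
    moreover have "\<forall>x\<in>set (replicate j c). c = x" by simp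
    ultimately show "(length (takeWhile ((=) c) (case p of (j, v) \<Rightarrow> replicate j c @ v)),
                dropWhile ((=) c) (case p of (j, v) \<Rightarrow> replicate j c @ v)) = p"
      by (simp add: p takeWhile_append dropWhile_append)
    show "(case p of (j, v) \<Rightarrow> replicate j c @ v) \<in> strings_from c n"
      using j v by (auto simp: p strings_from_def hd_append)
  qed
  then show ?thesis by (simp add: sum.Sigma finite_strings_from)
qed


section \<open>Generating functions\<close>

unbundle no vec_syntax
unbundle fps_syntax

lemma pmf_replicate_pmf: "pmf (replicate_pmf (length w) p) w = prod_list (map (pmf p) w)"
proof (induction w)
  case (Cons x w)
  have eq: "replicate_pmf (Suc n) p = map_pmf (\<lambda>(x, xs). x # xs) (pair_pmf p (replicate_pmf n p))" for n
    by (simp add: pair_pmf_def map_bind_pmf)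
  have "pmf (map_pmf (\<lambda>(x, xs). x # xs) (pair_pmf p (replicate_pmf (length w) p)))
              ((\<lambda>(x, xs). x # xs) (x, w)) = pmf (pair_pmf p (replicate_pmf (length w) p)) (x, w)"
    by (rule pmf_map_inj') (auto simp: inj_def)
  then show ?case using Cons unfolding length_Cons eq by (simp add: pmf_pair)
qed simp

definition string_term :: "real \<Rightarrow> nat \<Rightarrow> nat \<Rightarrow> bool list \<Rightarrow> real poly" where
  "string_term q k K w = monom (prod_list (map (pmf (bernoulli_pmf q)) w)) (total_runs k K w)"

definition string_gf :: "real \<Rightarrow> nat \<Rightarrow> nat \<Rightarrow> bool \<Rightarrow> real poly fps" where
  "string_gf q k K c = Abs_fps (\<lambda>n. \<Sum>w\<in>strings_from c n. string_term q k K w)"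

text \<open>The choices for one run of bits with weight \<open>a\<close>. The constant coefficient is 0 because a run
  is nonempty.\<close>

definition first_run_gf :: "'a :: comm_ring_1 \<Rightarrow> 'a \<Rightarrow> nat \<Rightarrow> nat \<Rightarrow> 'a fps" where
  "first_run_gf a y k K =
     Abs_fps (\<lambda>j. if j = 0 then 0 else a ^ j * (if j \<in> {k..K} then y else 1))"

text \<open>A probability is the sum of the weights of the strings in the event, and for \<open>n > 0\<close> the two
  families partition the strings of length \<open>n\<close>. At \<open>n = 0\<close> they overlap in the empty string.\<close>

lemma run_gf_eq_string_gf:
  "run_gf q k K = string_gf q k K True + string_gf q k K False"
proof (rule fps_ext, rule poly_eqI)
  fix n m
  show "coeff (run_gf q k K $ n) m =
          coeff ((string_gf q k K True + string_gf q k K False) $ n) m"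
  proof (cases "n = 0")
    case True
    then show ?thesis
      by (simp add: coeff_run_gf run_prob_def string_gf_def strings_from_0 string_term_def total_runs_Nil
          monom_0 numeral_poly coeff_pCons split: nat.split)
  next
    case False
    let ?p = "bernoulli_pmf q"
    let ?S = "strings_from True n \<union> strings_from False n"
    have S: "?S = {w. length w = n}" by (auto simp: strings_from_def)
    have fin: "finite ?S" by (simp add: finite_strings_from)
    have disj: "strings_from True n \<inter> strings_from False n = {}"
      using False by (auto simp: strings_from_def)
    have "coeff (run_gf q k K $ n) m =
            measure_pmf.prob (random_string q n) {w. total_runs k K w = m}"
      using False by (simp add: coeff_run_gf run_prob_def total_runs_def)
    also have "\<dots> = measure_pmf.prob (random_string q n) {w \<in> ?S. total_runs k K w = m}"
      by (rule measure_prob_cong_0)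
         (auto simp: S random_string_def pmf_eq_0_set_pmf set_replicate_pmf)
    also have "\<dots> = (\<Sum>w | w \<in> ?S \<and> total_runs k K w = m. pmf (random_string q n) w)"
      using fin by (intro measure_measure_pmf_finite) simp
    also have "\<dots> = (\<Sum>w | w \<in> ?S \<and> total_runs k K w = m. prod_list (map (pmf ?p) w))"
      by (rule sum.cong) (auto simp: S random_string_def pmf_replicate_pmf[symmetric])
    also have "\<dots> = (\<Sum>w\<in>?S. if total_runs k K w = m then prod_list (map (pmf ?p) w) else 0)"
      using fin by (subst sum.inter_filter) auto
    also have "\<dots> = coeff (\<Sum>w\<in>?S. string_term q k K w) m"
      by (simp add: coeff_sum string_term_def)
    also have "(\<Sum>w\<in>?S. string_term q k K w) =
                 (string_gf q k K True + string_gf q k K False) $ n"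
      by (simp add: string_gf_def sum.union_disjoint finite_strings_from disj)
    finally show ?thesis .
  qed
qed

lemma string_term_replicate_append:
  assumes "0 < j" and "v \<in> strings_from (\<not> c) n"
  shows "string_term q k K (replicate j c @ v) =
           first_run_gf [:pmf (bernoulli_pmf q) c:] [:0, 1:] k K $ j * string_term q k K v"
proof -
  have v: "v = [] \<or> hd v = (\<not> c)" using assms by (auto simp: strings_from_def)
  let ?a = "pmf (bernoulli_pmf q) c"
  have "first_run_gf [:?a:] [:0, 1:] k K $ j = monom (?a ^ j) (of_bool (j \<in> {k..K}))"
    using assms by (simp add: first_run_gf_def poly_const_pow monom_0 monom_Suc)
  then show ?thesis
    by (simp add: string_term_def total_runs_replicate_append[OF assms(1) v] mult_monom
        map_replicate_const prod_list_replicate)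
qed

lemma string_gf_rec:
  "string_gf q k K c =
     1 + first_run_gf [:pmf (bernoulli_pmf q) c:] [:0, 1:] k K * string_gf q k K (\<not> c)"
    (is "_ = 1 + ?R * _")
proof (rule fps_ext)
  fix n
  have R0: "?R $ 0 = 0" by (simp add: first_run_gf_def)
  show "string_gf q k K c $ n = (1 + ?R * string_gf q k K (\<not> c)) $ n"
  proof (cases "n = 0")
    case True
    then show ?thesis
      by (simp add: R0 string_gf_def strings_from_0 string_term_def total_runs_Nil)
  next
    case False
    have "string_gf q k K c $ n =
            (\<Sum>j=1..n. \<Sum>v\<in>strings_from (\<not> c) (n - j). string_term q k K (replicate j c @ v))"
      using False by (simp add: string_gf_def sum_strings_first_run)
    also have "\<dots> = (\<Sum>j=1..n. ?R $ j * string_gf q k K (\<not> c) $ (n - j))"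
      by (intro sum.cong refl)
         (simp add: string_gf_def sum_distrib_left string_term_replicate_append)
    also have "\<dots> = (?R * string_gf q k K (\<not> c)) $ n"
      by (simp add: fps_mult_nth sum.atLeast_Suc_atMost[of 0] R0)
    finally show ?thesis using False by simp
  qed
qed

text \<open>Multiplication by \<open>1 - x\<close> takes differences of consecutive coefficients, up to powers of
  \<open>a\<close>. Without the window \<open>{k..K}\<close> only \<open>x\<close> would survive; the window contributes \<open>y - 1\<close> where it
  opens, at \<open>k\<close>, and the opposite where it has closed, at \<open>K + 1\<close>. The condition \<open>k \<le> K\<close> keeps
  these two events in order, and \<open>1 \<le> k\<close> keeps the window away from the coefficient 0.\<close>

lemma first_run_gf_mult:
  fixes a y :: "'a :: comm_ring_1"
  defines "x \<equiv> fps_const a * fps_X"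
  assumes "1 \<le> k" and "k \<le> K"
  shows "first_run_gf a y k K * (1 - x) = (fps_const y - 1) * (x ^ k - x ^ (K + 1)) + x"
proof (rule fps_ext)
  fix n
  have xpow: "(x ^ i) $ n = (if n = i then a ^ n else 0)" for i
    by (simp add: x_def power_mult_distrib fps_X_power_nth)
  have "(fps_const y - 1) * (x ^ k - x ^ (K + 1)) = fps_const (y - 1) * (x ^ k - x ^ (K + 1))"
    by (simp flip: fps_const_1_eq_1 fps_const_sub)
  then have R: "((fps_const y - 1) * (x ^ k - x ^ (K + 1)) + x) $ n =
      (y - 1) * ((if n = k then a ^ n else 0) - (if n = K + 1 then a ^ n else 0)) +
      (if n = 1 then a else 0)"
    using xpow[of 1]
    by (simp only: fps_add_nth fps_sub_nth fps_mult_left_const_nth xpow power_one_right) simp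
  have "first_run_gf a y k K * (1 - x) =
          first_run_gf a y k K - fps_const a * (fps_X * first_run_gf a y k K)"
    by (simp add: x_def algebra_simps)
  then have L: "(first_run_gf a y k K * (1 - x)) $ n =
      first_run_gf a y k K $ n - a * (if n = 0 then 0 else first_run_gf a y k K $ (n - 1))"
    by simp
  show "(first_run_gf a y k K * (1 - x)) $ n =
          ((fps_const y - 1) * (x ^ k - x ^ (K + 1)) + x) $ n"
    unfolding L R unfolding first_run_gf_def using assms(2,3)
    by (cases n; cases "n - 1") (auto simp: algebra_simps le_Suc_eq)
qed

theorem mainTheorem15:
  fixes q :: real and k K :: nat
    and x0 x1 y Num Den :: "real poly fps"
  defines "x1 \<equiv> fps_const [:q:] * fps_X"
    and "x0 \<equiv> fps_const [:1 - q:] * fps_X"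
    and "y \<equiv> fps_const [:0, 1:]"
  defines "Num \<equiv> 2 - x1 - x0 + (y - 1) *
             ((x1 ^ k - x1 ^ (K + 1)) * (1 - x0) + (x0 ^ k - x0 ^ (K + 1)) * (1 - x1))"
    and "Den \<equiv> (1 - x1) * (1 - x0) -
             ((y - 1) * (x1 ^ k - x1 ^ (K + 1)) + x1) * ((y - 1) * (x0 ^ k - x0 ^ (K + 1)) + x0)"
  assumes "0 < q" and "q < 1" and "1 \<le> k" and "k \<le> K"
  shows "Den dvd 1 \<and> run_gf q k K * Den = Num"
proof
  have "Den $ 0 = 1"
    using assms(8) by (simp add: Den_def x0_def x1_def)
  then have "Den * fps_right_inverse Den 1 = 1"
    by (intro fps_right_inverse) simp
  then show "Den dvd 1" by (metis dvdI)
next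
  define A1 where "A1 = string_gf q k K True"
  define A0 where "A0 = string_gf q k K False"
  define R1 where "R1 = first_run_gf [:q:] [:0, 1:] k K"
  define R0 where "R0 = first_run_gf [:1 - q:] [:0, 1:] k K"
  define P1 where "P1 = (y - 1) * (x1 ^ k - x1 ^ (K + 1)) + x1"
  define P0 where "P0 = (y - 1) * (x0 ^ k - x0 ^ (K + 1)) + x0"
  have A1: "A1 = 1 + R1 * A0" and A0: "A0 = 1 + R0 * A1"
    using string_gf_rec[of q k K True] string_gf_rec[of q k K False] assms(6,7)
    by (simp_all add: A1_def A0_def R1_def R0_def)
  have P1: "R1 * (1 - x1) = P1" and P0: "R0 * (1 - x0) = P0"
    unfolding R1_def R0_def P1_def P0_def x1_def x0_def y_def
    by (rule first_run_gf_mult[OF assms(8,9)])+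
  \<comment> \<open>The linear system with the factors \<open>1 - x\<^sub>c\<close> cleared.\<close>
  have E1: "(1 - x1) * A1 = (1 - x1) + P1 * A0"
    unfolding P1[symmetric] by (subst A1) (simp add: algebra_simps)
  have E0: "(1 - x0) * A0 = (1 - x0) + P0 * A1"
    unfolding P0[symmetric] by (subst A0) (simp add: algebra_simps)
  have "A1 * Den = (1 - x0) * ((1 - x1) * A1) - P1 * (P0 * A1)"
    by (simp add: Den_def P1_def P0_def algebra_simps)
  also have "\<dots> = (1 - x0) * (1 - x1) + P1 * ((1 - x0) * A0 - P0 * A1)"
    unfolding E1 by (simp add: algebra_simps)
  also have "\<dots> = (1 - x0) * (1 - x1 + P1)"
    unfolding E0 by (simp add: algebra_simps)
  finally have D1: "A1 * Den = (1 - x0) * (1 - x1 + P1)" .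
  have "A0 * Den = (1 - x1) * ((1 - x0) * A0) - P0 * (P1 * A0)"
    by (simp add: Den_def P1_def P0_def algebra_simps)
  also have "\<dots> = (1 - x1) * (1 - x0) + P0 * ((1 - x1) * A1 - P1 * A0)"
    unfolding E0 by (simp add: algebra_simps)
  also have "\<dots> = (1 - x1) * (1 - x0 + P0)"
    unfolding E1 by (simp add: algebra_simps)
  finally have D0: "A0 * Den = (1 - x1) * (1 - x0 + P0)" .
  have "run_gf q k K * Den = A1 * Den + A0 * Den"
    by (simp add: run_gf_eq_string_gf A1_def A0_def distrib_right)
  also have "\<dots> = Num"
    unfolding D1 D0 Num_def P1_def P0_def by (simp add: algebra_simps)
  finally show "run_gf q k K * Den = Num" .
qed

end
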